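(* Let $\Gamma \subseteq \omega^\omega$ be a subshift of finite type. Then the shift map $\sigma$ on $\Gamma$ exhibits dense distributional chaos; that is, there exists a set $D \subseteq \Gamma$ that is uncountable, dense in $\Gamma$, and distributionally scrambled of type 1.
   Context: $\mathbb{N}=\{1,2,3,\dots\}$ and $\omega = \mathbb{N}\cup\{0\}$ with the discrete topology; $X=\omega^\omega$ (infinite sequences $x=x_0x_1x_2\dots$ over $\omega$) carries the product topology, which is compatible with the metric $d(x,y)=\inf_{n\in\omega}\{2^{-n} : x_i=y_i \ \forall i<n\}$. The shift map is $\sigma:X\to X$, $\sigma(x_0x_1x_2\dots)=x_1x_2\dots$. A subshift is a closed subset $\Gamma\subseteq\omega^\omega$ that is invariant under $\sigma$ ($\sigma(\Gamma)\subseteq\Gamma$). For $i<j$ write $x_{[i,j)}=x_ix_{i+1}\dots x_{j-1}$ (and likewise for finite words). A finite word $w$ over $\omega$ of length $n$ is an allowed word of $\Gamma$ if there are $x\in\Gamma$ and $i\in\omega$ with $w=x_{[i,i+n)}$; $B(\Gamma)$ is the set of all allowed words. A finite word not in $B(\Gamma)$ is a forbidden word. A set $\mathcal{F}(\Gamma)$ of forbidden words is a basis of forbidden words of $\Gamma$ if every forbidden word $w$ has a subword $w_{[i,j)}\in\mathcal{F}(\Gamma)$ with $0\le i<j\le |w|$, where $|w|$ is the length of $w$. A subshift $\Gamma$ is a subshift of finite type if it has a finite basis of forbidden words. Let $\xi(x,y,\epsilon,n)=|\{i : i<n,\ d(\sigma^i(x),\sigma^i(y))<\epsilon\}|$ (cardinality,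 $i\in\omega$). Points $x,y$ form a distributionally chaotic pair of type 1 (DC1 pair) if $\limsup_{n\to\infty}\frac1n\xi(x,y,\epsilon,n)=1$ for all $\epsilon>0$ and $\liminf_{n\to\infty}\frac1n\xi(x,y,\delta,n)=0$ for some $\delta>0$. A set $D\subseteq\Gamma$ is distributionally scrambled of type 1 if every pair $x\ne y$ in $D$ forms a DC1 pair. *)

theory Defs
  imports "HOL-Analysis.Analysis"
begin

text \<open>
  The space of sequences over \<open>\<omega> = {0, 1, 2, \<dots>}\<close> is the type \<^typ>\<open>nat \<Rightarrow> nat\<close>. Its type class
  topology is the product topology of the discrete topologies. The library metric \<^const>\<open>dist\<close> on
  this type is a different one and is not used; \<open>seq_dist\<close> is shown to be compatible with the
  topology in \<open>open_iff_seq_dist\<close> below.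
\<close>

definition seq_dist :: "(nat \<Rightarrow> nat) \<Rightarrow> (nat \<Rightarrow> nat) \<Rightarrow> real" where
  "seq_dist x y = Inf {1 / 2 ^ n | n :: nat. \<forall>i<n. x i = y i}"

definition shift :: "(nat \<Rightarrow> nat) \<Rightarrow> (nat \<Rightarrow> nat)" where
  "shift x = (\<lambda>i. x (Suc i))"

definition subshift :: "(nat \<Rightarrow> nat) set \<Rightarrow> bool" where
  "subshift \<Gamma> \<longleftrightarrow> closed \<Gamma> \<and> shift ` \<Gamma> \<subseteq> \<Gamma>"

text \<open>
  The word \<open>u\<^sub>i u\<^sub>i\<^sub>+\<^sub>1 \<dots> u\<^sub>j\<^sub>-\<^sub>1\<close>. For a finite word \<open>w\<close> it is used with \<open>u = (!) w\<close>, and only for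
  \<open>j \<le> length w\<close>.
\<close>

definition factor :: "(nat \<Rightarrow> nat) \<Rightarrow> nat \<Rightarrow> nat \<Rightarrow> nat list" where
  "factor u i j = map u [i..<j]"

definition allowed_words :: "(nat \<Rightarrow> nat) set \<Rightarrow> nat list set" where
  "allowed_words \<Gamma> = {w. \<exists>x\<in>\<Gamma>. \<exists>i. w = factor x i (i + length w)}"

definition forbidden_words :: "(nat \<Rightarrow> nat) set \<Rightarrow> nat list set" where
  "forbidden_words \<Gamma> = - allowed_words \<Gamma>"

definition forbidden_basis :: "(nat \<Rightarrow> nat) set \<Rightarrow> nat list set \<Rightarrow> bool" where
  "forbidden_basis \<Gamma> F \<longleftrightarrow>
     F \<subseteq> forbidden_words \<Gamma> \<and>
     (\<forall>w\<in>forbidden_words \<Gamma>. \<exists>i j. i < j \<and> j \<le> length w \<and> factor ((!) w) i j \<in> F)"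

definition subshift_of_finite_type :: "(nat \<Rightarrow> nat) set \<Rightarrow> bool" where
  "subshift_of_finite_type \<Gamma> \<longleftrightarrow> subshift \<Gamma> \<and> (\<exists>F. finite F \<and> forbidden_basis \<Gamma> F)"

definition prox_count :: "(nat \<Rightarrow> nat) \<Rightarrow> (nat \<Rightarrow> nat) \<Rightarrow> real \<Rightarrow> nat \<Rightarrow> nat" where
  "prox_count x y \<epsilon> n = card {i. i < n \<and> seq_dist ((shift ^^ i) x) ((shift ^^ i) y) < \<epsilon>}"

text \<open>The value at \<open>n = 0\<close> is \<open>0 / 0 = 0\<close> and does not affect the upper and lower limits.\<close>

definition DC1_pair :: "(nat \<Rightarrow> nat) \<Rightarrow> (nat \<Rightarrow> nat) \<Rightarrow> bool" where
  "DC1_pair x y \<longleftrightarrow>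
     (\<forall>\<epsilon>>0. limsup (\<lambda>n. ereal (real (prox_count x y \<epsilon> n) / real n)) = 1) \<and>
     (\<exists>\<delta>>0. liminf (\<lambda>n. ereal (real (prox_count x y \<delta> n) / real n)) = 0)"

definition distributionally_scrambled :: "(nat \<Rightarrow> nat) set \<Rightarrow> bool" where
  "distributionally_scrambled D \<longleftrightarrow> (\<forall>x\<in>D. \<forall>y\<in>D. x \<noteq> y \<longrightarrow> DC1_pair x y)"

lemma seq_dist_less_iff: "seq_dist x y < 1 / 2 ^ n \<longleftrightarrow> (\<forall>i\<le>n. x i = y i)"
proof -
  have bdd: "bdd_below {1 / 2 ^ n :: real | n :: nat. \<forall>i<n. x i = y i}"
    by (rule bdd_belowI[of _ 0]) auto
  have ne: "{1 / 2 ^ n :: real | n :: nat. \<forall>i<n. x i = y i} \<noteq> {}"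
    by (auto intro: exI[of _ 0])
  have "seq_dist x y < 1 / 2 ^ n \<longleftrightarrow> (\<exists>m. (\<forall>i<m. x i = y i) \<and> (1 / 2 ^ m :: real) < 1 / 2 ^ n)"
    unfolding seq_dist_def cInf_less_iff[OF ne bdd] by auto
  also have "\<dots> \<longleftrightarrow> (\<exists>m>n. \<forall>i<m. x i = y i)"
    by (auto simp: field_simps)
  also have "\<dots> \<longleftrightarrow> (\<forall>i\<le>n. x i = y i)"
    by (meson le_less_trans lessI less_Suc_eq_le)
  finally show ?thesis .
qed

lemma open_cylinder: "open {y :: nat \<Rightarrow> nat. \<forall>i\<le>n. x i = y i}"
proof -
  have "open (Pi\<^sub>E UNIV (\<lambda>i. if i \<le> n then {x i} else UNIV))"
    by (rule open_PiE) (auto simp: open_discrete intro: finite_subset[of _ "{..n}"])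
  also have "Pi\<^sub>E UNIV (\<lambda>i. if i \<le> n then {x i} else UNIV) = {y. \<forall>i\<le>n. x i = y i}"
    by (auto simp: PiE_iff split: if_splits)
  finally show ?thesis .
qed

lemma open_iff_seq_dist:
  "open U \<longleftrightarrow> (\<forall>x\<in>U. \<exists>\<epsilon>>0. \<forall>y. seq_dist x y < \<epsilon> \<longrightarrow> y \<in> U)"
proof (intro iffI ballI)
  fix x assume "open U" "x \<in> U"
  then obtain X where X: "x \<in> Pi\<^sub>E UNIV X" "finite {i. X i \<noteq> UNIV}" "Pi\<^sub>E UNIV X \<subseteq> U"
    using product_topology_open_contains_basis[of "\<lambda>_. euclidean" UNIV U x]
    by (auto simp: open_fun_def)
  obtain n where n: "\<And>i. X i \<noteq> UNIV \<Longrightarrow> i \<le> n"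
    using X(2) unfolding finite_nat_set_iff_bounded_le by auto
  have "y \<in> U" if "seq_dist x y < 1 / 2 ^ n" for y
  proof -
    have "y i \<in> X i" for i
      using that PiE_mem[OF X(1), of i] n[of i] unfolding seq_dist_less_iff
      by (cases "X i = UNIV") simp_all
    then show ?thesis using X(3) by (auto simp: PiE_iff)
  qed
  then show "\<exists>\<epsilon>>0. \<forall>y. seq_dist x y < \<epsilon> \<longrightarrow> y \<in> U"
    by (intro exI[of _ "1 / 2 ^ n"]) auto
next
  assume *: "\<forall>x\<in>U. \<exists>\<epsilon>>0. \<forall>y. seq_dist x y < \<epsilon> \<longrightarrow> y \<in> U"
  show "open U"
  proof (subst open_subopen, intro ballI)
    fix x assume "x \<in> U"
    then obtain \<epsilon> where \<epsilon>: "\<epsilon> > 0" "\<And>y. seq_dist x y < \<epsilon> \<Longrightarrow> y \<in> U" using * by blast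
    obtain n where n: "(1 / 2) ^ n < \<epsilon>" using real_arch_pow_inv[of \<epsilon> "1 / 2"] \<epsilon>(1) by auto
    have "{y. \<forall>i\<le>n. x i = y i} \<subseteq> U"
      using n \<epsilon>(2) by (force simp: seq_dist_less_iff[symmetric] power_one_over)
    then show "\<exists>T. open T \<and> x \<in> T \<and> T \<subseteq> U"
      using open_cylinder[of n x] by (intro exI[of _ "{y. \<forall>i\<le>n. x i = y i}"]) auto
  qed
qed

end

theory Submission
  imports Defs "HOL-Real_Asymp.Real_Asymp"
begin

text \<open>
  A finite basis of forbidden words involves only finitely many symbols, so all symbols from some
  \<open>a\<close> on are free: after an allowed word they may follow in any order. Since the alphabet is infinite,
  a whole finite sequence \<open>s\<^sub>0 \<dots> s\<^sub>m\<^sub>-\<^sub>1\<close> can be encoded in a single free symbol. To every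
  \<open>s \<in> \<omega>\<^sup>\<omega>\<close> corresponds the sequence that is constant on each block
  \<open>[m!, (m + 1)!)\<close>, with value \<open>a\<close> for even \<open>m\<close> and with the code of \<open>s\<^sub>0 \<dots> s\<^sub>m\<^sub>-\<^sub>1\<close> (shifted by
  \<open>a\<close>) for odd \<open>m\<close>. For \<open>s \<noteq> t\<close> these sequences agree on every even block and differ everywhere
  on almost every odd block; as each block is much longer than all previous ones together, this is
  a DC1 pair. The DC1 property does not depend on finite prefixes, so one can overwrite prefixes by
  allowed words, the choice of the word being dictated by \<open>s\<^sub>0\<close>, to make the set dense.
\<close>

subsection \<open>Subshifts of finite type\<close>

lemma shift_funpow: "(shift ^^ n) x = (\<lambda>i. x (n + i))"
  by (induction n) (auto simp: shift_def)

text \<open>The balls of \<open>seq_dist\<close> are the cylinders given by a common prefix. This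
  serves twice: for limits inside \<Gamma> and for density of the scrambled set.\<close>

lemma in_closure_if_prefixes:
  fixes x :: "nat \<Rightarrow> nat"
  assumes "\<And>n. \<exists>y\<in>D. \<forall>i<n. y i = x i"
  shows "x \<in> closure D"
proof -
  have "T \<inter> D \<noteq> {}" if T: "open T" "x \<in> T" for T
  proof -
    obtain e where e: "e > 0" "\<And>y. seq_dist x y < e \<Longrightarrow> y \<in> T"
      using T open_iff_seq_dist by blast
    obtain n where n: "(1 / 2) ^ n < e"
      using real_arch_pow_inv[of e "1 / 2"] e(1) by auto
    obtain y where y: "y \<in> D" "\<forall>i<Suc n. y i = x i"
      using assms by blast
    have "seq_dist x y < 1 / 2 ^ n"
      using y(2) by (simp add: seq_dist_less_iff)
    then have "y \<in> T"
      using n by (intro e(2)) (simp add: power_one_over)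
    then show ?thesis using y(1) by blast
  qed
  then show ?thesis
    unfolding closure_iff_nhds_not_empty by blast
qed

text \<open>Each prefix occurs somewhere in a point of \<Gamma>. Shift invariance moves that
  occurrence to position 0, and closedness gives the limit.\<close>

lemma in_subshift_if_prefixes_allowed:
  assumes "subshift \<Gamma>" and "\<And>n. map x [0..<n] \<in> allowed_words \<Gamma>"
  shows "x \<in> \<Gamma>"
proof -
  have inv: "(shift ^^ i) y \<in> \<Gamma>" if "y \<in> \<Gamma>" for i y
    using that assms(1) by (induction i) (auto simp: subshift_def)
  have "\<exists>z\<in>\<Gamma>. \<forall>i<n. z i = x i" for n
  proof -
    obtain y k where y: "y \<in> \<Gamma>" "map x [0..<n] = map y [k..<k + n]"
      using assms(2)[of n] by (auto simp: allowed_words_def factor_def)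
    have "y (k + i) = x i" if "i < n" for i
      using arg_cong[OF y(2), of "\<lambda>l. l ! i"] that by simp
    then show ?thesis
      using inv[OF y(1), of k] by (intro bexI[of _ "(shift ^^ k) y"]) (auto simp: shift_funpow)
  qed
  then have "x \<in> closure \<Gamma>"
    by (rule in_closure_if_prefixes)
  then show ?thesis
    using assms(1) by (simp add: subshift_def)
qed

lemma prefix_in_allowed_words: "x \<in> \<Gamma> \<Longrightarrow> map x [0..<n] \<in> allowed_words \<Gamma>"
  by (auto simp: allowed_words_def factor_def intro!: bexI[of _ x] exI[of _ 0])

lemma factor_in_allowed_words:
  assumes "w \<in> allowed_words \<Gamma>" "i \<le> j" "j \<le> length w"
  shows "factor ((!) w) i j \<in> allowed_words \<Gamma>"
proof -
  obtain y k where y: "y \<in> \<Gamma>" "w = map y [k..<k + length w]"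
    using assms(1) by (auto simp: allowed_words_def factor_def)
  have nth: "w ! l = y (k + l)" if "l < length w" for l
    using arg_cong[OF y(2), of "\<lambda>v. v ! l"] that by simp
  have "factor ((!) w) i j = factor y (k + i) (k + i + length (factor ((!) w) i j))"
    unfolding factor_def using assms(2,3) by (auto intro!: nth_equalityI simp: nth add.assoc)
  then show ?thesis
    using y(1) unfolding allowed_words_def by blast
qed

text \<open>A basis element must appear as a nonempty factor, and the empty word has none. In effect
  this says that \<Gamma> is nonempty.\<close>

lemma Nil_in_allowed_words:
  assumes "forbidden_basis \<Gamma> F"
  shows "[] \<in> allowed_words \<Gamma>"
proof (rule ccontr)
  assume "[] \<notin> allowed_words \<Gamma>"
  then have "[] \<in> forbidden_words \<Gamma>"
    by (simp add: forbidden_words_def)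
  then obtain i j :: nat where "i < j" "j \<le> length ([] :: nat list)"
    using assms unfolding forbidden_basis_def by blast
  then show False by simp
qed

definition overwrite :: "'a list \<Rightarrow> (nat \<Rightarrow> 'a) \<Rightarrow> nat \<Rightarrow> 'a" where
  "overwrite w x i = (if i < length w then w ! i else x i)"

text \<open>A factor from \<open>F\<close> would either lie inside \<open>w\<close>, and so be
  allowed, or end in a symbol of \<open>x\<close>, which no element of \<open>F\<close>
  contains.\<close>

lemma overwrite_in_subshift:
  assumes "subshift \<Gamma>" "forbidden_basis \<Gamma> F" "w \<in> allowed_words \<Gamma>"
    and free: "\<And>i u. u \<in> F \<Longrightarrow> x i \<notin> set u"
  shows "overwrite w x \<in> \<Gamma>"
proof (rule in_subshift_if_prefixes_allowed[OF assms(1)], rule ccontr)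
  fix n
  assume "map (overwrite w x) [0..<n] \<notin> allowed_words \<Gamma>"
  then have "map (overwrite w x) [0..<n] \<in> forbidden_words \<Gamma>"
    by (simp add: forbidden_words_def)
  then obtain i j where ij: "i < j" "j \<le> length (map (overwrite w x) [0..<n])"
      and "factor ((!) (map (overwrite w x) [0..<n])) i j \<in> F"
    using assms(2) unfolding forbidden_basis_def by blast
  moreover have "factor ((!) (map (overwrite w x) [0..<n])) i j = map (overwrite w x) [i..<j]"
    using ij by (auto simp: factor_def)
  ultimately have F: "map (overwrite w x) [i..<j] \<in> F" by simp
  show False
  proof (cases "j \<le> length w")
    case True
    then have "map (overwrite w x) [i..<j] = factor ((!) w) i j"
      by (auto simp: factor_def overwrite_def)
    then have "map (overwrite w x) [i..<j] \<in> allowed_words \<Gamma>"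
      using factor_in_allowed_words[OF assms(3), of i j] ij True by simp
    then show False
      using F assms(2) by (auto simp: forbidden_basis_def forbidden_words_def)
  next
    case False
    then have "x (j - 1) = overwrite w x (j - 1)"
      by (auto simp: overwrite_def)
    also have "\<dots> \<in> set (map (overwrite w x) [i..<j])"
      using ij by auto
    finally show False
      using free[OF F] by blast
  qed
qed

subsection \<open>DC1 pairs from factorial blocks\<close>

lemma prox_count_le: "prox_count x y e n \<le> n"
proof -
  have "prox_count x y e n \<le> card {..<n}"
    unfolding prox_count_def by (rule card_mono) auto
  then show ?thesis by simp
qed

text \<open>Closeness at position \<open>i\<close> inspects the coordinates from \<open>i\<close> to
  \<open>i + N\<close>, so the last \<open>N\<close> positions before \<open>n\<close> are given
  up.\<close>

lemma prox_count_ge: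
  assumes agree: "\<And>i. b \<le> i \<Longrightarrow> i < n \<Longrightarrow> x i = y i" and e: "1 / 2 ^ N \<le> e"
  shows "n - N - b \<le> prox_count x y e n"
proof -
  have "seq_dist ((shift ^^ i) x) ((shift ^^ i) y) < e" if "b \<le> i" "i < n - N" for i
  proof -
    have "seq_dist ((shift ^^ i) x) ((shift ^^ i) y) < 1 / 2 ^ N"
      using that by (auto simp: seq_dist_less_iff shift_funpow intro!: agree)
    then show ?thesis using e by simp
  qed
  then have "card {b..<n - N} \<le> prox_count x y e n"
    unfolding prox_count_def by (intro card_mono) auto
  then show ?thesis by simp
qed

lemma prox_count_one_le:
  assumes "\<And>i. b \<le> i \<Longrightarrow> i < n \<Longrightarrow> x i \<noteq> y i"
  shows "prox_count x y 1 n \<le> b"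
proof -
  have "{i. i < n \<and> seq_dist ((shift ^^ i) x) ((shift ^^ i) y) < 1} \<subseteq> {..<b}"
  proof safe
    fix i assume i: "i < n" and "seq_dist ((shift ^^ i) x) ((shift ^^ i) y) < 1"
    then have "x i = y i"
      using seq_dist_less_iff[of "(shift ^^ i) x" "(shift ^^ i) y" 0] by (simp add: shift_funpow)
    then show "i < b" using assms[of i] i by fastforce
  qed
  then have "prox_count x y 1 n \<le> card {..<b}"
    unfolding prox_count_def by (intro card_mono) auto
  then show ?thesis by simp
qed

text \<open>At the end of block \<open>m\<close>, all earlier blocks together make up only the
  fraction \<open>fact m / fact (m + 1) = 1 / (m + 1)\<close>. Ends of even blocks give the upper
  limit, ends of odd blocks the lower one with radius 1.\<close>

lemma DC1_pairI:
  assumes agree: "\<forall>\<^sub>F m in sequentially. \<forall>i. fact (2 * m) \<le> i \<and> i < fact (2 * m + 1) \<longrightarrow> x i = y i"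
    and differ: "\<forall>\<^sub>F m in sequentially. \<forall>i. fact (2 * m + 1) \<le> i \<and> i < fact (2 * m + 2) \<longrightarrow> x i \<noteq> y i"
  shows "DC1_pair x y"
  unfolding DC1_pair_def
proof (intro conjI allI impI)
  fix e :: real assume e: "e > 0"
  let ?f = "\<lambda>n. real (prox_count x y e n) / real n"
  let ?r = "\<lambda>m :: nat. fact (2 * m + 1) :: nat"
  obtain N where "(1 / 2) ^ N < e"
    using real_arch_pow_inv[of e "1 / 2"] e by auto
  then have N: "1 / 2 ^ N \<le> e"
    by (simp add: power_one_over)
  have le1: "?f n \<le> 1" for n
    using prox_count_le[of x y e n] by (cases "n = 0") (auto simp: field_simps)
  have ge: "\<forall>\<^sub>F m in sequentially. 1 - real (N + 1) / real (2 * m + 1) \<le> ?f (?r m)"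
    using agree
  proof eventually_elim
    case (elim m)
    have "?r m - N - fact (2 * m) \<le> prox_count x y e (?r m)"
      by (rule prox_count_ge[OF _ N]) (use elim in blast)
    \<comment> \<open>The factor 1 is there to be enlarged to \<open>fact (2 * m)\<close>, so that
      the loss of \<open>N\<close> positions is absorbed into a multiple of the earlier
      blocks.\<close>
    then have "?r m \<le> prox_count x y e (?r m) + (N * 1 + fact (2 * m))"
      by linarith
    also have "\<dots> \<le> prox_count x y e (?r m) + (N * fact (2 * m) + fact (2 * m))"
      by (intro add_mono mult_mono) (auto simp: fact_ge_1)
    finally have "real (?r m) \<le> real (prox_count x y e (?r m) + (N + 1) * fact (2 * m))"
      by (subst of_nat_le_iff) (simp add: algebra_simps)
    then have "1 \<le> ?f (?r m) + real ((N + 1) * fact (2 * m)) / real (?r m)"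
      by (simp add: field_simps del: fact_Suc)
    also have "real ((N + 1) * fact (2 * m)) / real (?r m) = real (N + 1) / real (2 * m + 1)"
      by (simp only: fact_Suc Suc_eq_plus1[symmetric] of_nat_mult) simp
    finally show ?case by simp
  qed
  have lim: "(\<lambda>m. 1 - real (N + 1) / real (2 * m + 1)) \<longlonglongrightarrow> 1"
    by real_asymp
  have "(\<lambda>m. ?f (?r m)) \<longlonglongrightarrow> 1"
    by (rule tendsto_sandwich[OF ge always_eventually lim tendsto_const]) (use le1 in blast)
  then have "limsup ((\<lambda>n. ereal (?f n)) \<circ> ?r) = 1"
    by (intro lim_imp_Limsup) (auto simp: o_def one_ereal_def)
  moreover have "strict_mono ?r"
    by (rule strict_monoI) (rule fact_less_mono_nat; simp)
  ultimately have "1 \<le> limsup (\<lambda>n. ereal (?f n))"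
    using limsup_subseq_mono[of ?r "\<lambda>n. ereal (?f n)"] by simp
  moreover have "limsup (\<lambda>n. ereal (?f n)) \<le> 1"
    by (rule Limsup_bounded) (use le1 in \<open>simp add: one_ereal_def\<close>)
  ultimately show "limsup (\<lambda>n. ereal (?f n)) = 1"
    by simp
next
  let ?f = "\<lambda>n. real (prox_count x y 1 n) / real n"
  let ?r = "\<lambda>m :: nat. fact (2 * m + 2) :: nat"
  have le: "\<forall>\<^sub>F m in sequentially. ?f (?r m) \<le> 1 / real (2 * m + 2)"
    using differ
  proof eventually_elim
    case (elim m)
    have "prox_count x y 1 (?r m) \<le> fact (2 * m + 1)"
      by (rule prox_count_one_le) (use elim in blast)
    then have "?f (?r m) \<le> real (fact (2 * m + 1)) / real (?r m)"
      by (intro divide_right_mono) (auto simp del: fact_Suc of_nat_fact)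
    also have "\<dots> = 1 / real (2 * m + 2)"
      using fact_Suc[of "2 * m + 1", where 'a = real] by (simp add: divide_simps del: fact_Suc)
    finally show ?case .
  qed
  have lim: "(\<lambda>m. 1 / real (2 * m + 2)) \<longlonglongrightarrow> 0"
    by real_asymp
  have "(\<lambda>m. ?f (?r m)) \<longlonglongrightarrow> 0"
    by (rule tendsto_sandwich[OF always_eventually le tendsto_const lim]) simp
  then have "liminf ((\<lambda>n. ereal (?f n)) \<circ> ?r) = 0"
    by (intro lim_imp_Liminf) (auto simp: o_def zero_ereal_def)
  moreover have "strict_mono ?r"
    by (rule strict_monoI) (rule fact_less_mono_nat; simp)
  ultimately have "liminf (\<lambda>n. ereal (?f n)) \<le> 0"
    using liminf_subseq_mono[of ?r "\<lambda>n. ereal (?f n)"] by simp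
  moreover have "0 \<le> liminf (\<lambda>n. ereal (?f n))"
    by (rule Liminf_bounded) simp
  ultimately have "liminf (\<lambda>n. ereal (?f n)) = 0"
    by simp
  then show "\<exists>d>0. liminf (\<lambda>n. ereal (real (prox_count x y d n) / real n)) = 0"
    by (intro exI[of _ 1]) simp
qed

section \<open>Sequences coded on factorial blocks\<close>

text \<open>Position 0 lies before \<open>fact 0 = 1\<close> and in no factorial interval; it gets
  index 0.\<close>

definition block :: "nat \<Rightarrow> nat" where
  "block i = (LEAST m. i < fact (Suc m))"

lemma block_eq:
  assumes "fact m \<le> i" "i < fact (Suc m)"
  shows "block i = m"
  unfolding block_def
proof (rule Least_equality)
  show "i < fact (Suc m)" by fact
next
  fix k assume "i < fact (Suc k)"
  then have "(fact m :: nat) < fact (Suc k)"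
    using assms(1) by (rule le_less_trans[rotated])
  then have "\<not> Suc k \<le> m"
    using fact_mono_nat[of "Suc k" m] by linarith
  then show "m \<le> k" by simp
qed

definition block_code :: "nat \<Rightarrow> (nat \<Rightarrow> nat) \<Rightarrow> nat \<Rightarrow> nat" where
  "block_code a s i = a + (if even (block i) then 0 else to_nat (map s [0..<block i]))"

lemma DC1_pair_overwrite_block_code:
  assumes "s \<noteq> t"
  shows "DC1_pair (overwrite v (block_code a s)) (overwrite w (block_code a t))"
proof (rule DC1_pairI)
  define L where "L = length v + length w"
  \<comment> \<open>Since \<open>m \<le> fact m\<close>, blocks with index at least \<open>L\<close>
    start beyond both overwritten prefixes.\<close>
  have tail: "overwrite v (block_code a s) i = block_code a s i"
      "overwrite w (block_code a t) i = block_code a t i"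
    if "L \<le> m" "fact m \<le> i" for m i :: nat
    using that fact_ge_self[of m] by (auto simp: overwrite_def L_def)
  show "\<forall>\<^sub>F m in sequentially. \<forall>i. fact (2 * m) \<le> i \<and> i < fact (2 * m + 1) \<longrightarrow>
      overwrite v (block_code a s) i = overwrite w (block_code a t) i"
    using eventually_ge_at_top[of L]
  proof eventually_elim
    case (elim m)
    show ?case
    proof (intro allI impI)
      fix i :: nat assume i: "fact (2 * m) \<le> i \<and> i < fact (2 * m + 1)"
      then have "block i = 2 * m" by (intro block_eq) auto
      then show "overwrite v (block_code a s) i = overwrite w (block_code a t) i"
        using tail[of "2 * m" i] i elim by (simp add: block_code_def)
    qed
  qed
  obtain k where k: "s k \<noteq> t k" using assms by blast
  show "\<forall>\<^sub>F m in sequentially. \<forall>i. fact (2 * m + 1) \<le> i \<and> i < fact (2 * m + 2) \<longrightarrow>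
      overwrite v (block_code a s) i \<noteq> overwrite w (block_code a t) i"
    using eventually_ge_at_top[of "max L k"]
  proof eventually_elim
    case (elim m)
    show ?case
    proof (intro allI impI)
      fix i :: nat assume i: "fact (2 * m + 1) \<le> i \<and> i < fact (2 * m + 2)"
      then have b: "block i = 2 * m + 1" by (intro block_eq) auto
      \<comment> \<open>The coded prefixes now reach position \<open>k\<close>, where
        \<open>s\<close> and \<open>t\<close> differ; injectivity of \<open>to_nat\<close> separates
        their codes.\<close>
      have "k \<in> set [0..<2 * m + 1]" using elim by (simp del: upt_Suc)
      then have "map s [0..<2 * m + 1] \<noteq> map t [0..<2 * m + 1]"
        using k by (meson map_eq_conv)
      then have "block_code a s i \<noteq> block_code a t i"
        by (simp add: block_code_def b del: upt_Suc)
      then show "overwrite v (block_code a s) i \<noteq> overwrite w (block_code a t) i"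
        using tail[of "2 * m + 1" i] i elim by simp
    qed
  qed
qed

text \<open>This turns the DC1 property of images of distinct sequences into injectivity, hence
  uncountability of the range.\<close>

lemma not_DC1_pair_refl: "\<not> DC1_pair x x"
proof
  assume "DC1_pair x x"
  then obtain d where d: "d > 0" "liminf (\<lambda>n. ereal (real (prox_count x x d n) / real n)) = 0"
    by (auto simp: DC1_pair_def)
  obtain N where "(1 / 2) ^ N < d"
    using real_arch_pow_inv[of d "1 / 2"] d(1) by auto
  then have "seq_dist z z < d" for z
    using seq_dist_less_iff[of z z N] by (simp add: power_one_over)
  then have "prox_count x x d n = n" for n
    by (simp add: prox_count_def)
  \<comment> \<open>At \<open>n = 0\<close> the quotient is 0, so it equals 1 only from
    \<open>n = 1\<close> on.\<close>
  moreover have "(\<lambda>n. ereal (real n / real n)) \<longlonglongrightarrow> 1"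
    by (rule tendsto_eventually) (auto intro!: eventually_sequentiallyI[of 1])
  ultimately show False
    using d(2) lim_imp_Liminf[of sequentially "\<lambda>n. ereal (real n / real n)" 1] by simp
qed

lemma uncountable_UNIV_nat_fun: "uncountable (UNIV :: (nat \<Rightarrow> nat) set)"
proof
  assume "countable (UNIV :: (nat \<Rightarrow> nat) set)"
  then obtain f :: "nat \<Rightarrow> nat \<Rightarrow> nat" where f: "range f = UNIV"
    using uncountable_def by blast
  have "(\<lambda>n. Suc (f n n)) \<in> range f"
    unfolding f by simp
  then obtain k where "f k = (\<lambda>n. Suc (f n n))" by auto
  then have "f k k = Suc (f k k)" by (rule fun_cong)
  then show False by simp
qed

theorem theorem15:
  fixes \<Gamma> :: "(nat \<Rightarrow> nat) set"
  assumes "subshift_of_finite_type \<Gamma>"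
  shows "\<exists>D. D \<subseteq> \<Gamma> \<and> uncountable D \<and> \<Gamma> \<subseteq> closure D \<and> distributionally_scrambled D"
proof -
  obtain F where F: "subshift \<Gamma>" "finite F" "forbidden_basis \<Gamma> F"
    using assms by (auto simp: subshift_of_finite_type_def)
  have "finite (\<Union> (set ` F))"
    using F(2) by auto
  then obtain a where "\<forall>c\<in>\<Union> (set ` F). c < a"
    unfolding finite_nat_set_iff_bounded by blast
  then have a: "c \<notin> set u" if "a \<le> c" "u \<in> F" for c u
    using that by fastforce
  \<comment> \<open>Every allowed word is decoded from some value of \<open>s 0\<close>; values that
    decode to a forbidden word fall back to the empty prefix.\<close>
  define word where "word s = (let w = from_nat (s 0) in if w \<in> allowed_words \<Gamma> then w else [])"
    for s :: "nat \<Rightarrow> nat"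
  define p where "p s = overwrite (word s) (block_code a s)" for s
  have DC1: "DC1_pair (p s) (p t)" if "s \<noteq> t" for s t
    unfolding p_def using that by (rule DC1_pair_overwrite_block_code)
  have "p s \<in> \<Gamma>" for s
    unfolding p_def
  proof (rule overwrite_in_subshift[OF F(1,3)])
    show "word s \<in> allowed_words \<Gamma>"
      using Nil_in_allowed_words[OF F(3)] by (simp add: word_def Let_def)
    show "block_code a s i \<notin> set u" if "u \<in> F" for i u
      using that by (intro a) (auto simp: block_code_def)
  qed
  moreover have "inj p"
    by (rule injI) (metis DC1 not_DC1_pair_refl)
  then have "uncountable (range p)"
    using uncountable_UNIV_nat_fun countable_image_inj_on by blast
  moreover have "x \<in> closure (range p)" if "x \<in> \<Gamma>" for x
  proof (rule in_closure_if_prefixes)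
    fix n
    \<comment> \<open>Only the value at 0 selects the prefix, so a constant sequence
      suffices.\<close>
    have "word (\<lambda>_. to_nat (map x [0..<n])) = map x [0..<n]"
      using prefix_in_allowed_words[OF that, of n] by (simp add: word_def)
    then have "\<forall>i<n. p (\<lambda>_. to_nat (map x [0..<n])) i = x i"
      by (simp add: p_def overwrite_def)
    then show "\<exists>y\<in>range p. \<forall>i<n. y i = x i" by blast
  qed
  moreover have "distributionally_scrambled (range p)"
    unfolding distributionally_scrambled_def using DC1 by (metis rangeE)
  ultimately show ?thesis
    by (intro exI[of _ "range p"]) blast
qed

end
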